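(* Let $A,B\in\mathbb{R}^{n\times n}$. The following conditions are equivalent: (i) the system $AX+B|X|=F$ has a unique solution $X\in\mathbb{R}^{n\times n}$ for each $F\in\mathbb{R}^{n\times n}$; (ii) the matrix $A+BD$ is nonsingular for every $D\in[-I_n,I_n]$; (iii) the system $Ax+B|x|=b$ has a unique solution $x\in\mathbb{R}^n$ for each $b\in\mathbb{R}^n$; (iv) for any upper triangular matrices $C,E\in\mathbb{R}^{n\times n}$ with ones on the diagonals, the system $AXC+B|X|E=F$ has a unique solution $X\in\mathbb{R}^{n\times n}$ for each $F\in\mathbb{R}^{n\times n}$.
   Context: Absolute values and inequalities of vectors and matrices are understood entrywise. $I_n$ is the $n\times n$ identity matrix, and $[-I_n,I_n]$ is the set of matrices $D$ with $-I_n\leq D\leq I_n$ entrywise, i.e. diagonal matrices with diagonal entries in $[-1,1]$. In (iv), "for any" means "for all". *)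

theory Defs
  imports "HOL-Analysis.Analysis"
begin

text \<open>
  An \<open>n \<times> n\<close> real matrix has type \<open>real ^ 'n ^ 'n\<close> with \<open>n = CARD('n)\<close>; the linear order
  on \<open>'n\<close> plays the role of the order of the indices \<open>1, \<dots>, n\<close>. On vectors and matrices,
  the library's \<open>\<bar>_\<bar>\<close>, \<open>\<le>\<close> and hence \<open>{_.._}\<close> are entrywise, so no separate notion
  is introduced for \<open>\<bar>X\<bar>\<close> or for the interval matrix \<open>{- mat 1..mat 1}\<close>.
\<close>

text \<open>
  Written with \<open>vec\<close> because \<open>real ^ 'n\<close> attaches the sort \<open>finite\<close> to \<open>'n\<close>, which clashes with
  \<open>'n::{finite,linorder}\<close>.
\<close>

type_synonym 'n rvec = "(real, 'n) vec"
type_synonym 'n sqmat = "((real, 'n) vec, 'n) vec"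

definition upper_triangular_matrix :: "'n::{finite,linorder} sqmat \<Rightarrow> bool" where
  "upper_triangular_matrix C \<longleftrightarrow> (\<forall>i j. j < i \<longrightarrow> C $ i $ j = 0)"

lemma abs_matrix_entry:
  fixes X :: "real ^ 'n ^ 'm"
  shows "\<bar>X\<bar> $ i $ j = \<bar>X $ i $ j\<bar>"
  by (simp add: abs_vec_def)

lemma matrix_interval_iff:
  fixes D :: "real ^ 'n ^ 'n"
  shows "D \<in> {- mat 1..mat 1} \<longleftrightarrow>
    (\<forall>i. \<bar>D $ i $ i\<bar> \<le> 1) \<and> (\<forall>i j. i \<noteq> j \<longrightarrow> D $ i $ j = 0)"
proof
  assume "D \<in> {- mat 1..mat 1}"
  then have *: "- (mat 1 :: real ^ 'n ^ 'n) $ i $ j \<le> D $ i $ j \<and> D $ i $ j \<le> (mat 1 :: real ^ 'n ^ 'n) $ i $ j" for i j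
    by (simp add: less_eq_vec_def)
  show "(\<forall>i. \<bar>D $ i $ i\<bar> \<le> 1) \<and> (\<forall>i j. i \<noteq> j \<longrightarrow> D $ i $ j = 0)"
  proof (intro conjI allI impI)
    fix i show "\<bar>D $ i $ i\<bar> \<le> 1"
      using *[of i i] by (simp add: mat_def abs_le_iff minus_le_iff)
  next
    fix i j :: 'n assume "i \<noteq> j"
    then show "D $ i $ j = 0"
      using *[of i j] by (simp add: mat_def)
  qed
next
  assume "(\<forall>i. \<bar>D $ i $ i\<bar> \<le> 1) \<and> (\<forall>i j. i \<noteq> j \<longrightarrow> D $ i $ j = 0)"
  then show "D \<in> {- mat 1..mat 1}"
    by (simp add: less_eq_vec_def mat_def abs_le_iff minus_le_iff)
qed

end

theory Submission
  imports Defs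
begin

text \<open>
  Let \<open>f x = A x + B \<bar>x\<bar>\<close>, and write a matrix of the interval \<open>[-I, I]\<close> as \<open>diag d\<close> with
  \<open>d \<in> [-1, 1]\<close>. Two identities link \<open>f\<close> to the matrices \<open>A + B diag d\<close>: on the orthant with
  sign vector \<open>d\<close> the map \<open>f\<close> is linear with matrix \<open>A + B diag d\<close>, and every difference
  \<open>f x - f y\<close> equals \<open>(A + B diag d) (x - y)\<close> for some \<open>d \<in> [-1, 1]\<close>, because the absolute
  value is 1-Lipschitz in each coordinate.

  If all \<open>A + B diag d\<close> are nonsingular, the second identity makes \<open>f\<close> injective. An injective
  continuous \<open>f\<close> has an open range by invariance of domain; since \<open>f\<close> is positively homogeneous,
  the range is closed under positive scaling, and an open set around \<open>0\<close> with that property is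
  the whole space (\<open>positively_homogeneous_inj_imp_surj\<close>). So unique solvability of the vector
  equation is the same as injectivity of \<open>f\<close>.

  Conversely, let \<open>f\<close> be injective. Then \<open>A + B diag d\<close> is nonsingular for each sign vector \<open>d\<close>,
  and the determinants at two sign vectors that differ in one coordinate have the same sign:
  otherwise \<open>f\<close> would fold the two adjacent orthants onto the same side of the image of their
  common face (\<open>abs_equation_adjacent_orthants\<close>). Hence all \<open>2\<^sup>n\<close> vertex determinants have one
  sign. The determinant is affine in each \<open>d\<^sub>i\<close>, so on the cube it is a convex combination of
  the vertex values and does not vanish (\<open>abs_equation_cube_det_sign\<close>).

  The matrix equations reduce to the vector equation column by column. With unit upper triangular
  \<open>C\<close> and \<open>E\<close>, column \<open>j\<close> of \<open>A X C + B \<bar>X\<bar> E\<close> is \<open>f\<close> of column \<open>j\<close> of \<open>X\<close> plus terms in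
  earlier columns, so the columns are determined one after another. The choice \<open>C = E = I\<close> gives
  back \<open>A X + B \<bar>X\<bar> = F\<close>, and a right-hand side with constant columns gives back the vector equation.
\<close>

section \<open>Diagonal perturbations of a matrix\<close>

definition diag_matrix :: "real ^ 'n \<Rightarrow> real ^ 'n ^ 'n" where
  "diag_matrix d = (\<chi> i j. if i = j then d $ i else 0)"

lemma diag_matrix_vector_mult: "diag_matrix d *v x = d * x"
  by (simp add: diag_matrix_def vec_eq_iff matrix_vector_mult_def if_distrib[of "\<lambda>t. t * _"] cong: if_cong)

lemma matrix_interval_eq_diag_matrix:
  "{- mat 1..mat 1} = diag_matrix ` {- 1..1 :: real ^ 'n}"
proof (intro set_eqI iffI)
  fix D :: "real ^ 'n ^ 'n"
  assume "D \<in> {- mat 1..mat 1}"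
  then have "D = diag_matrix (\<chi> i. D $ i $ i)" "(\<chi> i. D $ i $ i) \<in> {- 1..1}"
    unfolding matrix_interval_iff
    by (auto simp: diag_matrix_def vec_eq_iff less_eq_vec_def abs_le_iff minus_le_iff)
  then show "D \<in> diag_matrix ` {- 1..1}"
    by blast
next
  fix D :: "real ^ 'n ^ 'n"
  assume "D \<in> diag_matrix ` {- 1..1}"
  then show "D \<in> {- mat 1..mat 1}"
    unfolding matrix_interval_iff
    by (auto simp: diag_matrix_def less_eq_vec_def abs_le_iff minus_le_iff)
qed

lemma pencil_vector_mult:
  "(A + B ** diag_matrix d) *v x = A *v x + B *v (d * x)"
  by (simp add: matrix_vector_mult_add_rdistrib matrix_vector_mul_assoc[symmetric] diag_matrix_vector_mult)

lemma column_pencil: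
  "column j (A + B ** diag_matrix d) = column j A + (d $ j) *s column j B"
  by (simp add: column_def diag_matrix_def matrix_matrix_mult_def vec_eq_iff
      if_distrib[of "\<lambda>t. _ * t"] mult.commute cong: if_cong)

lemma invertible_iff_kernel_trivial:
  fixes M :: "real ^ 'n ^ 'n"
  shows "invertible M \<longleftrightarrow> (\<forall>x. M *v x = 0 \<longrightarrow> x = 0)"
  using invertible_left_inverse matrix_left_invertible_ker by blast

section \<open>Determinants as functions of one column\<close>

lemma det_column_combination:
  fixes M P Q :: "real ^ 'n ^ 'n"
  assumes P: "\<And>j. j \<noteq> i \<Longrightarrow> column j P = column j M"
    and Q: "\<And>j. j \<noteq> i \<Longrightarrow> column j Q = column j M"
    and M: "column i M = s *s column i P + t *s column i Q"
  shows "det M = s * det P + t * det Q"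
proof -
  have rows: "transpose R = (\<chi> k. if k = i then column i R else column k M)"
    if "\<And>j. j \<noteq> i \<Longrightarrow> column j R = column j M" for R :: "real ^ 'n ^ 'n"
    using that by (auto simp: vec_eq_iff transpose_def column_def)
  have "det (transpose M) = s * det (transpose P) + t * det (transpose Q)"
    unfolding rows[of P, OF P, simplified] rows[of Q, OF Q, simplified] rows[OF refl] M det_row_add det_row_mul ..
  then show ?thesis
    by simp
qed

text \<open>
  Cramer's rule, read as a description of how the determinant changes along one column.
\<close>

lemma det_replace_column:
  fixes M M' :: "real ^ 'n ^ 'n"
  assumes "\<And>j. j \<noteq> i \<Longrightarrow> column j M' = column j M"
    and "column i M' = M *v w"
  shows "det M' = w $ i * det M"
proof -
  have "M' = (\<chi> k j. if j = i then (M *v w) $ k else M $ k $ j)"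
    using assms by (auto simp: vec_eq_iff column_def)
  then show ?thesis
    by (simp add: cramer_lemma)
qed

section \<open>Injectivity forces nonsingularity\<close>

lemma abs_eq_sign_mult:
  fixes x :: "real ^ 'n"
  assumes "\<And>i. 0 \<le> d $ i * x $ i" and "\<And>i. \<bar>d $ i\<bar> = 1"
  shows "\<bar>x\<bar> = d * x"
proof -
  have "\<bar>x $ i\<bar> = d $ i * x $ i" for i
    using assms[of i] by (metis abs_mult abs_of_nonneg mult_1)
  then show ?thesis
    by (simp add: vec_eq_iff abs_vec_def)
qed

text \<open>
  The orthant of the sign vector \<open>d\<close> contains arbitrarily large balls, so a kernel vector \<open>v\<close> of
  the matrix that represents the map there can be moved into it: some \<open>x\<close> and \<open>x + v\<close> both lie in
  the orthant and have the same image.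
\<close>

lemma abs_equation_orthant_invertible:
  fixes A B :: "real ^ 'n ^ 'n"
  assumes inj: "inj (\<lambda>x. A *v x + B *v \<bar>x\<bar>)"
    and d: "\<And>i. \<bar>d $ i\<bar> = 1"
  shows "invertible (A + B ** diag_matrix d)"
  unfolding invertible_iff_kernel_trivial
proof (intro allI impI)
  fix v assume v: "(A + B ** diag_matrix d) *v v = 0"
  \<comment> \<open>far enough from every coordinate hyperplane that adding \<open>v\<close> does not leave the orthant\<close>
  define x where "x = norm v *\<^sub>R d"
  have dd: "d $ i * d $ i = 1" for i
    using d[of i] by (metis abs_mult_self_eq mult_1)
  have dv: "\<bar>d $ i * v $ i\<bar> \<le> norm v" for i
    using component_le_norm_cart[of v i] d[of i] by (simp add: abs_mult)
  have "\<bar>x\<bar> = d * x"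
    by (rule abs_eq_sign_mult) (use dd d in \<open>simp_all add: x_def mult.left_commute\<close>)
  moreover have "\<bar>x + v\<bar> = d * (x + v)"
    by (rule abs_eq_sign_mult)
       (use dd dv d in \<open>simp_all add: x_def distrib_left mult.left_commute abs_le_iff\<close>,
         smt (verit) dv)
  ultimately have "A *v (x + v) + B *v \<bar>x + v\<bar> = A *v x + B *v \<bar>x\<bar>"
    using v unfolding pencil_vector_mult by (simp add: distrib_left matrix_vector_right_distrib)
  then have "x + v = x"
    by (rule injD[OF inj])
  then show "v = 0"
    by simp
qed

text \<open>
  By \<open>det_replace_column\<close>, \<open>w $ i\<close> is the quotient of the determinants belonging to the two
  orthants that share the face \<open>x $ i = 0\<close>. If it were not positive, then for a point \<open>y\<close> of
  that face, far from its boundary, \<open>y - w\<close> would lie in the orthant of \<open>d\<close> and \<open>y - axis i 1\<close> in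
  that of \<open>e\<close>. The two linear pieces agree at \<open>y\<close>, and the equation for \<open>w\<close> says that they
  subtract the same vector, so the two points would have the same image.
\<close>

lemma abs_equation_adjacent_orthants:
  fixes A B :: "real ^ 'n ^ 'n"
  assumes inj: "inj (\<lambda>x. A *v x + B *v \<bar>x\<bar>)"
    and d: "\<And>j. \<bar>d $ j\<bar> = 1" and e: "\<And>j. \<bar>e $ j\<bar> = 1"
    and eq: "\<And>j. j \<noteq> i \<Longrightarrow> e $ j = d $ j" and di: "d $ i = 1" and ei: "e $ i = - 1"
    and w: "column i (A + B ** diag_matrix e) = (A + B ** diag_matrix d) *v w"
  shows "0 < w $ i"
proof (rule ccontr)
  assume "\<not> 0 < w $ i"
  then have wi: "w $ i \<le> 0" by simp
  define y :: "real ^ 'n" where "y = (\<chi> j. if j = i then 0 else norm w * d $ j)"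
  have dd: "d $ j * d $ j = 1" for j
    using d[of j] by (metis abs_mult_self_eq mult_1)
  have dw: "\<bar>d $ j * w $ j\<bar> \<le> norm w" for j
    using component_le_norm_cart[of w j] d[of j] by (simp add: abs_mult)
  have y: "d * y = e * y"
    using eq by (auto simp: vec_eq_iff y_def)
  have x1: "\<bar>y - w\<bar> = d * (y - w)"
  proof (rule abs_eq_sign_mult)
    fix j
    show "0 \<le> d $ j * (y - w) $ j"
    proof (cases "j = i")
      case True
      then show ?thesis using wi di by (simp add: y_def)
    next
      case False
      then show ?thesis
        using dd[of j] dw[of j] by (simp add: y_def right_diff_distrib mult.left_commute)
    qed
  qed (rule d)
  have x2: "\<bar>y - axis i 1\<bar> = e * (y - axis i 1)"
  proof (rule abs_eq_sign_mult)
    fix j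
    show "0 \<le> e $ j * (y - axis i 1) $ j"
      using eq[of j] ei dd[of j] by (cases "j = i") (simp_all add: y_def axis_def mult.left_commute)
  qed (rule e)
  have "A *v (y - w) + B *v \<bar>y - w\<bar> = A *v y + B *v (d * y) - (A + B ** diag_matrix d) *v w"
    by (simp add: x1 pencil_vector_mult right_diff_distrib matrix_vector_mult_diff_distrib)
  also have "\<dots> = A *v y + B *v (e * y) - (A + B ** diag_matrix e) *v axis i 1"
    by (simp add: y w[symmetric] matrix_vector_mult_basis)
  also have "\<dots> = A *v (y - axis i 1) + B *v \<bar>y - axis i 1\<bar>"
    by (simp add: x2 pencil_vector_mult right_diff_distrib matrix_vector_mult_diff_distrib)
  finally have "y - w = y - axis i 1"
    by (rule injD[OF inj])
  then have "w $ i = 1"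
    by simp
  with wi show False by simp
qed

text \<open>
  Every sign vector is reached from the all-ones vector by flipping one coordinate at a time, and each
  flip multiplies the determinant by a positive number. The product with the determinant at the
  all-ones vector serves as a way to say "same nonzero sign".
\<close>

lemma abs_equation_orthant_det_sign:
  fixes A B :: "real ^ 'n ^ 'n"
  assumes inj: "inj (\<lambda>x. A *v x + B *v \<bar>x\<bar>)"
    and "\<And>j. \<bar>d $ j\<bar> = 1"
  shows "0 < det (A + B ** diag_matrix d) * det (A + B ** diag_matrix 1)"
proof -
  define sg :: "'n set \<Rightarrow> real ^ 'n" where "sg S = (\<chi> j. if j \<in> S then - 1 else 1)" for S
  let ?g = "\<lambda>S. det (A + B ** diag_matrix (sg S))"
  have sg1: "\<bar>sg S $ j\<bar> = 1" for S j
    by (simp add: sg_def)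
  have "0 < ?g S * ?g {}" for S :: "'n set"
  proof (induction S rule: finite_induct[OF finite])
    case 1
    show ?case
      using abs_equation_orthant_invertible[OF inj sg1, of "{}"]
      by (simp add: invertible_det_nz zero_less_mult_iff) linarith
  next
    case (2 i S)
    let ?M = "A + B ** diag_matrix (sg S)" and ?M' = "A + B ** diag_matrix (sg (insert i S))"
    obtain w where w: "column i ?M' = ?M *v w"
      using abs_equation_orthant_invertible[OF inj sg1, of S]
      by (metis invertible_right_inverse matrix_right_invertible_surjective surjD)
    have "det ?M' = w $ i * det ?M"
      by (rule det_replace_column[OF _ w]) (simp add: column_pencil sg_def)
    moreover have "0 < w $ i"
      by (rule abs_equation_adjacent_orthants[OF inj sg1 sg1 _ _ _ w]) (use 2 in \<open>auto simp: sg_def\<close>)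
    ultimately show ?case
      using 2 by (simp add: mult.assoc)
  qed
  moreover have "d = sg {j. d $ j = - 1}"
    using assms(2) by (auto simp: sg_def vec_eq_iff) (metis abs_eq_iff')
  moreover have "sg {} = 1"
    by (simp add: sg_def vec_eq_iff)
  ultimately show ?thesis
    by metis
qed

text \<open>
  The induction frees the coordinates one at a time from \<open>{-1, 1}\<close> to \<open>[-1, 1]\<close>. In a freed
  coordinate the determinant is affine, hence lies between its values at the two endpoints.
\<close>

lemma abs_equation_cube_det_sign:
  fixes A B :: "real ^ 'n ^ 'n"
  assumes inj: "inj (\<lambda>x. A *v x + B *v \<bar>x\<bar>)"
    and "d \<in> {- 1..1}"
  shows "0 < det (A + B ** diag_matrix d) * det (A + B ** diag_matrix 1)"
proof -
  let ?g = "\<lambda>d. det (A + B ** diag_matrix d) * det (A + B ** diag_matrix 1)"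
  have "0 < ?g d" if "\<And>j. \<bar>d $ j\<bar> \<le> 1" "\<And>j. j \<notin> S \<Longrightarrow> \<bar>d $ j\<bar> = 1" for S d
    using finite[of S] that
  proof (induction S arbitrary: d rule: finite_induct)
    case empty
    then show ?case
      by (intro abs_equation_orthant_det_sign[OF inj]) auto
  next
    case (insert i S)
    define dp where "dp = (\<chi> j. if j = i then 1 else d $ j)"
    define dm where "dm = (\<chi> j. if j = i then - 1 else d $ j)"
    have p: "0 < ?g dp" and m: "0 < ?g dm"
      using insert.prems by (intro insert.IH; force simp: dp_def dm_def)+
    \<comment> \<open>the weights express \<open>d $ i\<close> as a convex combination of \<open>1\<close> and \<open>- 1\<close>\<close>
    have "det (A + B ** diag_matrix d) =
        (1 + d $ i) / 2 * det (A + B ** diag_matrix dp) + (1 - d $ i) / 2 * det (A + B ** diag_matrix dm)"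
    proof (rule det_column_combination[where i = i])
      show "column i (A + B ** diag_matrix d) =
          ((1 + d $ i) / 2) *s column i (A + B ** diag_matrix dp) +
          ((1 - d $ i) / 2) *s column i (A + B ** diag_matrix dm)"
        by (simp add: column_pencil dp_def dm_def vec_eq_iff field_simps)
    qed (simp_all add: column_pencil dp_def dm_def)
    then have "- ?g d = (1 + d $ i) / 2 * - ?g dp + (1 - d $ i) / 2 * - ?g dm"
      by (simp add: algebra_simps)
    also have "\<dots> < 0"
    proof (rule convex_bound_lt)
      show "- ?g dp < 0" "- ?g dm < 0"
        using p m by simp_all
      show "0 \<le> (1 + d $ i) / 2" "0 \<le> (1 - d $ i) / 2" "(1 + d $ i) / 2 + (1 - d $ i) / 2 = 1"
        using insert.prems(1)[of i] by (auto simp: abs_le_iff field_simps)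
    qed
    finally show ?case
      by simp
  qed
  from this[of d UNIV] assms(2) show ?thesis
    by (auto simp: less_eq_vec_def abs_le_iff minus_le_iff)
qed

lemma inj_abs_equation_imp_invertible:
  fixes A B :: "real ^ 'n ^ 'n"
  assumes "inj (\<lambda>x. A *v x + B *v \<bar>x\<bar>)" and "d \<in> {- 1..1}"
  shows "invertible (A + B ** diag_matrix d)"
  using abs_equation_cube_det_sign[OF assms] by (auto simp: invertible_det_nz)

section \<open>Nonsingularity forces unique solvability\<close>

lemma abs_diff_eq_mult_diff:
  fixes x y :: "real ^ 'n"
  obtains d where "d \<in> {- 1..1}" "\<bar>x\<bar> - \<bar>y\<bar> = d * (x - y)"
proof
  \<comment> \<open>where \<open>x $ i = y $ i\<close> both sides vanish, and division by zero gives a value in \<open>[-1, 1]\<close>\<close>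
  let ?d = "\<chi> i. (\<bar>x $ i\<bar> - \<bar>y $ i\<bar>) / (x $ i - y $ i)"
  have "\<bar>?d $ i\<bar> \<le> 1" for i
    by (auto simp: divide_le_eq_1)
  then show "?d \<in> {- 1..1}"
    unfolding abs_le_iff by (simp add: less_eq_vec_def minus_le_iff)
  show "\<bar>x\<bar> - \<bar>y\<bar> = ?d * (x - y)"
    by (simp add: vec_eq_iff abs_vec_def)
qed

lemma invertible_imp_inj_abs_equation:
  fixes A B :: "real ^ 'n ^ 'n"
  assumes inv: "\<And>d. d \<in> {- 1..1} \<Longrightarrow> invertible (A + B ** diag_matrix d)"
  shows "inj (\<lambda>x. A *v x + B *v \<bar>x\<bar>)"
proof (rule injI)
  fix x y assume eq: "A *v x + B *v \<bar>x\<bar> = A *v y + B *v \<bar>y\<bar>"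
  obtain d where d: "d \<in> {- 1..1}" "\<bar>x\<bar> - \<bar>y\<bar> = d * (x - y)"
    by (rule abs_diff_eq_mult_diff)
  have "(A + B ** diag_matrix d) *v (x - y) = 0"
    using eq unfolding pencil_vector_mult d(2)[symmetric]
    by (simp add: matrix_vector_mult_diff_distrib algebra_simps)
  then show "x = y"
    using inv[OF d(1)] unfolding invertible_iff_kernel_trivial by (metis right_minus_eq)
qed

text \<open>
  By invariance of domain the range contains a ball around \<open>f 0 = 0\<close>. Every vector has a positive
  multiple in that ball, and homogeneity rescales the preimage.
\<close>

lemma positively_homogeneous_inj_imp_surj:
  fixes f :: "'a::euclidean_space \<Rightarrow> 'a"
  assumes cont: "continuous_on UNIV f" and inj: "inj f"
    and hom: "\<And>c x. 0 < c \<Longrightarrow> f (c *\<^sub>R x) = c *\<^sub>R f x"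
  shows "surj f"
proof -
  have "open (range f)"
    using invariance_of_domain[OF cont open_UNIV inj] .
  moreover have "f 0 = 0"
    using hom[of 2 0] by (simp add: scaleR_2)
  ultimately obtain r where r: "0 < r" "cball 0 r \<subseteq> range f"
    by (metis open_contains_cball rangeI)
  have "y \<in> range f" for y
  proof -
    define c where "c = r / (norm y + 1)"
    have c: "0 < c" using r(1) by (simp add: c_def add_nonneg_pos)
    have "norm (c *\<^sub>R y) \<le> r"
      using r(1) by (simp add: c_def divide_le_eq add_nonneg_pos)
    then obtain x where x: "f x = c *\<^sub>R y"
      using r(2) by (metis imageE mem_cball_0 subsetD)
    have "f (inverse c *\<^sub>R x) = y"
      using c by (simp add: hom x)
    then show ?thesis by blast
  qed
  then show ?thesis by blast
qed

lemma inj_imp_surj_abs_equation: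
  fixes A B :: "real ^ 'n ^ 'n"
  assumes "inj (\<lambda>x. A *v x + B *v \<bar>x\<bar>)"
  shows "surj (\<lambda>x. A *v x + B *v \<bar>x\<bar>)"
proof (rule positively_homogeneous_inj_imp_surj[OF _ assms])
  show "continuous_on UNIV (\<lambda>x. A *v x + B *v \<bar>x\<bar>)"
    unfolding abs_vec_def
    by (intro continuous_intros matrix_vector_mult_linear_continuous_on
        continuous_on_compose2[OF matrix_vector_mult_linear_continuous_on[where S = UNIV and A = B]]) auto
  fix c :: real and x :: "real ^ 'n"
  assume "0 < c"
  then have "\<bar>c *\<^sub>R x\<bar> = c *\<^sub>R \<bar>x\<bar>"
    by (simp add: vec_eq_iff abs_vec_def abs_mult)
  then show "A *v (c *\<^sub>R x) + B *v \<bar>c *\<^sub>R x\<bar> = c *\<^sub>R (A *v x + B *v \<bar>x\<bar>)"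
    by (simp add: matrix_vector_mult_scaleR scaleR_add_right)
qed

theorem abs_equation_unique_solution_iff:
  fixes A B :: "real ^ 'n ^ 'n"
  shows "(\<forall>b. \<exists>!x. A *v x + B *v \<bar>x\<bar> = b)
    \<longleftrightarrow> (\<forall>D \<in> {- mat 1..mat 1}. invertible (A + B ** D))"
proof -
  let ?f = "\<lambda>x. A *v x + B *v \<bar>x\<bar>"
  have "(\<forall>b. \<exists>!x. ?f x = b) \<longleftrightarrow> bij ?f"
    by (simp add: bij_iff)
  also have "\<dots> \<longleftrightarrow> inj ?f"
    using inj_imp_surj_abs_equation by (auto simp: bij_def)
  also have "\<dots> \<longleftrightarrow> (\<forall>D \<in> {- mat 1..mat 1}. invertible (A + B ** D))"
    unfolding matrix_interval_eq_diag_matrix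
    using inj_abs_equation_imp_invertible[of A B] invertible_imp_inj_abs_equation[of A B] by blast
  finally show ?thesis .
qed

section \<open>Triangular systems of matrix equations\<close>

text \<open>
  Abstract forward substitution: if the condition on the value at \<open>x\<close> involves only values at
  predecessors of \<open>x\<close> and always has exactly one solution, the whole family has exactly one solution.
\<close>

lemma wf_unique_choice:
  assumes wf: "wf R"
    and adm: "\<And>f g x r. (\<And>z. (z, x) \<in> R \<Longrightarrow> f z = g z) \<Longrightarrow> P f x r = P g x r"
    and ex1: "\<And>f x. \<exists>!r. P f x r"
  shows "\<exists>!f. \<forall>x. P f x (f x)"
proof (rule ex_ex1I)
  show "\<exists>f. \<forall>x. P f x (f x)"
    by (rule dependent_wf_choice[OF wf adm]) (use ex1 in blast)+
next
  fix f g assume f: "\<forall>x. P f x (f x)" and g: "\<forall>x. P g x (g x)"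
  have "f x = g x" for x
    using wf
  proof (induction x rule: wf_induct_rule)
    case (less x)
    then have "P f x = P g x"
      using adm by blast
    with f g ex1 show ?case
      by metis
  qed
  then show "f = g" by blast
qed

lemma wf_less_finite_linorder: "wf {(x, y :: 'n::{finite,linorder}). x < y}"
  by (rule wf_subset[OF wf_measure[of "\<lambda>x. card {..<x}"]]) (auto intro!: psubset_card_mono)

lemma unitriangular_sum:
  fixes C :: "'n::{finite,linorder} sqmat" and v :: "'n \<Rightarrow> 'a::real_vector"
  assumes "upper_triangular_matrix C" "C $ j $ j = 1"
  shows "(\<Sum>k\<in>UNIV. C $ k $ j *\<^sub>R v k) = v j + (\<Sum>k | k < j. C $ k $ j *\<^sub>R v k)"
proof -
  have "(\<Sum>k\<in>UNIV. C $ k $ j *\<^sub>R v k) = (\<Sum>k\<in>insert j {k. k < j}. C $ k $ j *\<^sub>R v k)"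
    using assms(1) by (intro sum.mono_neutral_right) (auto simp: upper_triangular_matrix_def neq_iff)
  then show ?thesis
    using assms(2) by simp
qed

lemma column_add: "column j (X + Y) = column j X + column j Y"
  by (simp add: column_def vec_eq_iff)

lemma column_matrix_mult: "column j (X ** Y) = X *v column j Y"
  by (simp add: column_def vec_eq_iff matrix_matrix_mult_def matrix_vector_mult_def)

lemma column_mult_eq_sum:
  fixes X :: "real ^ 'n ^ 'm" and C :: "real ^ 'k ^ 'n"
  shows "column j (X ** C) = (\<Sum>k\<in>UNIV. C $ k $ j *\<^sub>R column k X)"
  by (simp add: column_def vec_eq_iff matrix_matrix_mult_def mult.commute)

lemma column_abs: "column j \<bar>X\<bar> = \<bar>column j X\<bar>"
  for X :: "real ^ 'n ^ 'm"
  by (simp add: column_def vec_eq_iff abs_vec_def)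

lemma matrix_eq_iff_columns: "X = Y \<longleftrightarrow> (\<forall>j. column j X = column j Y)"
  by (auto simp: column_def vec_eq_iff)

text \<open>
  A matrix is the same as the family of its columns; this form transfers unique existence, so that
  forward substitution can work with functions.
\<close>

lemma ex1_matrix_iff_ex1_columns:
  "(\<exists>!X :: 'a ^ 'n ^ 'm. P (\<lambda>j. column j X)) \<longleftrightarrow> (\<exists>!f. P f)"
proof -
  let ?h = "\<lambda>f :: 'n \<Rightarrow> 'a ^ 'm. \<chi> i j. f j $ i"
  have 1: "(\<lambda>j. column j (?h f)) = f" for f
    by (simp add: column_def fun_eq_iff vec_eq_iff)
  have 2: "?h (\<lambda>j. column j X) = X" for X
    by (simp add: column_def vec_eq_iff)
  show ?thesis
    by (metis 1 2)
qed

text \<open>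
  Column \<open>j\<close> of the equation is a vector equation for column \<open>j\<close> of \<open>X\<close> whose right-hand side
  depends only on the columns before \<open>j\<close>, because \<open>C\<close> and \<open>E\<close> vanish below the diagonal and have
  ones on it.
\<close>

lemma unitriangular_abs_equation_unique_solution:
  fixes A B C E F :: "'n::{finite,linorder} sqmat"
  assumes uniq: "\<And>b. \<exists>!x. A *v x + B *v \<bar>x\<bar> = b"
    and C: "upper_triangular_matrix C" "\<And>i. C $ i $ i = 1"
    and E: "upper_triangular_matrix E" "\<And>i. E $ i $ i = 1"
  shows "\<exists>!X. A ** X ** C + B ** \<bar>X\<bar> ** E = F"
proof -
  \<comment> \<open>the contribution of the columns before \<open>j\<close> to column \<open>j\<close> of the left-hand side\<close>
  define T where "T f j = (\<Sum>k | k < j. C $ k $ j *\<^sub>R (A *v f k)) + (\<Sum>k | k < j. E $ k $ j *\<^sub>R (B *v \<bar>f k\<bar>))"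
    for f :: "'n \<Rightarrow> 'n rvec" and j
  define P where "P f j x \<longleftrightarrow> A *v x + B *v \<bar>x\<bar> = column j F - T f j" for f j x
  have "\<exists>!f. \<forall>j. P f j (f j)"
  proof (rule wf_unique_choice[OF wf_less_finite_linorder])
    fix f g :: "'n \<Rightarrow> 'n rvec" and j x
    assume "\<And>k. (k, j) \<in> {(x, y). x < y} \<Longrightarrow> f k = g k"
    then have "T f j = T g j"
      unfolding T_def by (intro arg_cong2[where f = "(+)"] sum.cong) auto
    then show "P f j x = P g j x"
      by (simp add: P_def)
  qed (simp add: P_def uniq)
  then have "\<exists>!X :: 'n sqmat. \<forall>j. P (\<lambda>j. column j X) j (column j X)"
    by (rule ex1_matrix_iff_ex1_columns[where P = "\<lambda>f. \<forall>j. P f j (f j)", THEN iffD2])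
  moreover have "A ** X ** C + B ** \<bar>X\<bar> ** E = F \<longleftrightarrow> (\<forall>j. P (\<lambda>j. column j X) j (column j X))" for X
  proof -
    have "column j (A ** X ** C + B ** \<bar>X\<bar> ** E) =
        A *v column j X + B *v \<bar>column j X\<bar> + T (\<lambda>j. column j X) j" for j
      unfolding column_add column_mult_eq_sum[where C = C] column_mult_eq_sum[where C = E] unitriangular_sum[OF C] unitriangular_sum[OF E]
      by (simp add: column_matrix_mult column_abs T_def)
    then show ?thesis
      unfolding matrix_eq_iff_columns P_def by (simp add: eq_diff_eq)
  qed
  ultimately show ?thesis
    by simp
qed

text \<open>
  A vector \<open>x\<close> solves the vector equation iff the matrix with all columns equal to \<open>x\<close> solves the
  matrix equation whose right-hand side has all columns equal to \<open>b\<close>.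
\<close>

lemma matrix_abs_equation_imp_vector:
  fixes A B :: "real ^ 'n ^ 'n"
  assumes mat: "\<And>F :: real ^ 'n ^ 'n. \<exists>!X :: real ^ 'n ^ 'n. A ** X + B ** \<bar>X\<bar> = F"
  shows "\<exists>!x. A *v x + B *v \<bar>x\<bar> = b"
proof -
  define K :: "real ^ 'n \<Rightarrow> real ^ 'n ^ 'n" where "K x = (\<chi> i j. x $ i)" for x
  have K: "column j (K x) = x" for x j
    by (simp add: K_def column_def vec_eq_iff)
  have col: "column j (A ** X + B ** \<bar>X\<bar>) = A *v column j X + B *v \<bar>column j X\<bar>" for X :: "real ^ 'n ^ 'n" and j
    by (simp add: column_add column_matrix_mult column_abs)
  show ?thesis
  proof (rule ex_ex1I)
    obtain X where X: "A ** X + B ** \<bar>X\<bar> = K b"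
      using ex1_implies_ex[OF mat] by blast
    fix j
    have "A *v column j X + B *v \<bar>column j X\<bar> = b"
      using col[of j X] unfolding X K by simp
    then show "\<exists>x. A *v x + B *v \<bar>x\<bar> = b"
      by blast
  next
    fix x y assume "A *v x + B *v \<bar>x\<bar> = b" "A *v y + B *v \<bar>y\<bar> = b"
    then have "A ** K x + B ** \<bar>K x\<bar> = K b" "A ** K y + B ** \<bar>K y\<bar> = K b"
      unfolding matrix_eq_iff_columns col K by simp_all
    then have "K x = K y"
      using mat[of "K b"] by metis
    then have "column j (K x) = column j (K y)" for j
      by simp
    then show "x = y"
      by (simp add: K)
  qed
qed

theorem theorem13:
  fixes A B :: "'n::{finite,linorder} sqmat"
  shows
    "((\<forall>F :: 'n sqmat. \<exists>!X :: 'n sqmat. A ** X + B ** \<bar>X\<bar> = F)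
      \<longleftrightarrow> (\<forall>D \<in> {- mat 1..mat 1}. invertible (A + B ** D))) \<and>
     ((\<forall>D \<in> {- mat 1..mat 1}. invertible (A + B ** D))
      \<longleftrightarrow> (\<forall>b :: 'n rvec. \<exists>!x :: 'n rvec. A *v x + B *v \<bar>x\<bar> = b)) \<and>
     ((\<forall>b :: 'n rvec. \<exists>!x :: 'n rvec. A *v x + B *v \<bar>x\<bar> = b)
      \<longleftrightarrow> (\<forall>C E :: 'n sqmat.
            upper_triangular_matrix C \<and> (\<forall>i. C $ i $ i = 1) \<and>
            upper_triangular_matrix E \<and> (\<forall>i. E $ i $ i = 1) \<longrightarrow>
            (\<forall>F :: 'n sqmat. \<exists>!X :: 'n sqmat.
              A ** X ** C + B ** \<bar>X\<bar> ** E = F)))"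
    (is "(?i \<longleftrightarrow> ?ii) \<and> (?ii \<longleftrightarrow> ?iii) \<and> (?iii \<longleftrightarrow> ?iv)")
proof -
  have "?iii \<longleftrightarrow> ?ii"
    by (rule abs_equation_unique_solution_iff)
  moreover have ?iii if ?i
    using matrix_abs_equation_imp_vector that by blast
  moreover have ?iv if ?iii
    by (intro allI impI unitriangular_abs_equation_unique_solution) (use that in simp_all)
  moreover have ?i if iv: ?iv
  proof -
    have "upper_triangular_matrix (mat 1 :: 'n sqmat) \<and> (\<forall>i. (mat 1 :: 'n sqmat) $ i $ i = 1)"
      by (auto simp: upper_triangular_matrix_def mat_def)
    then show ?thesis
      using iv[rule_format, of "mat 1" "mat 1"] by simp
  qed
  ultimately show ?thesis
    by argo
qed

end
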